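(* Let $q$ be a power of a prime $p$. For every $n\ge1$, one has in $\mathbb F_q[B,C]$ $$\mathcal U_n(B,C)=\prod_{\substack{d\mid n\\ d>1}}\Lambda_d(B,C)\qquad\text{and}\qquad \mathcal V_n(B,C)=\prod_{\substack{d\mid 2n\\ d\nmid n}}\Lambda_d(B,C),$$ where for $n=1$ the product $\prod_{d\mid n,\,d>1}\Lambda_d(B,C)$ is set to be $1$.
   Context: Let $B,C$ be algebraically independent indeterminates over $\mathbb F_q$. Lucas polynomials: $\mathcal U_0=0$, $\mathcal U_1=1$, $\mathcal U_n=-B\,\mathcal U_{n-1}-C\,\mathcal U_{n-2}$ and $\mathcal V_0=2$, $\mathcal V_1=-B$, $\mathcal V_n=-B\,\mathcal V_{n-1}-C\,\mathcal V_{n-2}$ for $n\ge2$. Lucas atoms: let $\alpha,\beta$ be the two roots of $T^2+BT+C$ in an algebraic closure of $\mathbb F_q(B,C)$. Let $\Phi_n(X)\in\mathbb F_q[X]$ be the $n$-th cyclotomic polynomial over $\mathbb F_q$ (the image of the integral one, also when $p\mid n$), $\varphi$ Euler's totient function, and $\Phi_n^{\mathrm{hom}}(\alpha,\beta)=\beta^{\varphi(n)}\Phi_n(\alpha/\beta)$. Set $\Lambda_1=1$, and for $n\ge2$ the $n$-th Lucas atom $\Lambda_n(B,C)\in\mathbb F_q[B,C]$ is the unique polynomial with $\Lambda_n(B,C)=\Phi_n^{\mathrm{hom}}(\alpha,\beta)$. *)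

theory Defs
  imports
    Complex_Main
    "HOL-Algebra.Algebraic_Closure_Type"
    "HOL-Number_Theory.Totient"
begin

text \<open>
  The ring \<open>F[B, C]\<close> is represented as the iterated polynomial ring \<open>F[C][B]\<close>, i.e. the
  type \<open>'a poly poly\<close>: the outer variable is \<open>B\<close>, and the variable of the coefficients is \<open>C\<close>.
\<close>

definition indet_B :: "'a::comm_ring_1 poly poly" where
  "indet_B = [:0, 1:]"

definition indet_C :: "'a::comm_ring_1 poly poly" where
  "indet_C = [:[:0, 1:]:]"

fun lucas_U :: "nat \<Rightarrow> 'a::comm_ring_1 poly poly" where
  "lucas_U 0 = 0"
| "lucas_U (Suc 0) = 1"
| "lucas_U (Suc (Suc n)) = - indet_B * lucas_U (Suc n) - indet_C * lucas_U n"

fun lucas_V :: "nat \<Rightarrow> 'a::comm_ring_1 poly poly" where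
  "lucas_V 0 = 2"
| "lucas_V (Suc 0) = - indet_B"
| "lucas_V (Suc (Suc n)) = - indet_B * lucas_V (Suc n) - indet_C * lucas_V n"

definition primitive_roots_of_unity :: "nat \<Rightarrow> complex set" where
  "primitive_roots_of_unity n = {z. z ^ n = 1 \<and> (\<forall>m. 0 < m \<and> m < n \<longrightarrow> z ^ m \<noteq> 1)}"

definition cyclotomic_int :: "nat \<Rightarrow> int poly" where
  "cyclotomic_int n =
     (THE P. map_poly of_int P = (\<Prod>z\<in>primitive_roots_of_unity n. [:- z, 1:]))"

definition cyclotomic :: "nat \<Rightarrow> 'a::comm_ring_1 poly" where
  "cyclotomic n = map_poly of_int (cyclotomic_int n)"

type_synonym 'a lucas_closure = "'a poly poly fract alg_closure"

text \<open>The embedding of \<open>F[B, C]\<close> into the algebraic closure of its field of fractions.\<close>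

definition emb :: "'a::field poly poly \<Rightarrow> 'a lucas_closure" where
  "emb P = to_ac (to_fract P)"

definition emb_const :: "'a::field \<Rightarrow> 'a lucas_closure" where
  "emb_const c = emb [:[:c:]:]"

text \<open>
  The factorisation \<open>T\<^sup>2 + B T + C = (T - \<alpha>) (T - \<beta>)\<close> determines \<open>\<alpha>\<close> and \<open>\<beta>\<close> up to order.
\<close>

definition lucas_roots :: "'a::field lucas_closure \<Rightarrow> 'a lucas_closure \<Rightarrow> bool" where
  "lucas_roots \<alpha> \<beta> \<longleftrightarrow> [:emb indet_C, emb indet_B, 1:] = [:- \<alpha>, 1:] * [:- \<beta>, 1:]"

definition cyclotomic_hom ::
    "nat \<Rightarrow> 'a::field lucas_closure \<Rightarrow> 'a lucas_closure \<Rightarrow> 'a lucas_closure" where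
  "cyclotomic_hom n \<alpha> \<beta> =
     \<beta> ^ totient n * poly (map_poly emb_const (cyclotomic n)) (\<alpha> / \<beta>)"

text \<open>
  For \<open>n \<ge> 2\<close> the value \<open>cyclotomic_hom n \<alpha> \<beta>\<close> is symmetric in \<open>\<alpha>\<close> and \<open>\<beta>\<close>, so requiring the
  equation for both orders of the roots is no restriction. The value at \<open>n = 0\<close> is irrelevant.
\<close>

definition lucas_atom :: "nat \<Rightarrow> 'a::field poly poly" where
  "lucas_atom n =
     (if n = 1 then 1
      else (THE L. \<forall>\<alpha> \<beta>. lucas_roots \<alpha> \<beta> \<longrightarrow> emb L = cyclotomic_hom n \<alpha> \<beta>))"

end

(* By Binet, (a - b) U_n = a^n - b^n and V_n = a^n + b^n, where a, b are the roots of
   T^2 + B T + C; homogenising X^n - 1 = prod_{d | n} Phi_d gives the first identity after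
   cancelling Phi_1^hom = a - b, and the second follows from U_{2n} = U_n V_n.
   The atoms exist because Phi_n is palindromic for n >= 2, so that Phi_n^hom is an integer
   combination of the elements (a b)^i (a^j + b^j) = C^i V_j and possibly a power of C. *)
theory Submission
  imports Defs
begin

section \<open>Integer polynomials mapped into other rings, and division by monic ones\<close>

lemma map_poly_of_int_mult:
  "map_poly of_int (P * Q) = (map_poly of_int P * map_poly of_int Q :: 'a::comm_ring_1 poly)"
  by (simp add: poly_eq_iff coeff_map_poly coeff_mult)

lemma map_poly_of_int_diff:
  "map_poly of_int (P - Q) = (map_poly of_int P - map_poly of_int Q :: 'a::comm_ring_1 poly)"
  by (simp add: poly_eq_iff coeff_map_poly)

lemma map_poly_of_int_add:
  "map_poly of_int (P + Q) = (map_poly of_int P + map_poly of_int Q :: 'a::comm_ring_1 poly)"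
  by (simp add: poly_eq_iff coeff_map_poly)

lemma map_poly_of_int_prod:
  "map_poly of_int (prod f A) = (\<Prod>x\<in>A. map_poly of_int (f x) :: 'a::comm_ring_1 poly)"
  by (induction A rule: infinite_finite_induct) (simp_all add: map_poly_of_int_mult)

lemma map_poly_of_int_monom_minus_1:
  "map_poly of_int (monom 1 n - 1) = (monom 1 n - 1 :: 'a::comm_ring_1 poly)"
  by (simp add: map_poly_of_int_diff map_poly_monom)

lemma map_poly_of_int_eq_iff:
  "map_poly of_int P = (map_poly of_int Q :: 'a::{comm_ring_1,ring_char_0} poly) \<longleftrightarrow> P = Q"
  by (simp add: poly_eq_iff coeff_map_poly)

lemma degree_map_poly_of_int:
  "degree (map_poly of_int P :: 'a::{comm_ring_1,ring_char_0} poly) = degree P"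
  by (rule degree_map_poly) auto

lemma lead_coeff_map_poly_of_int:
  "lead_coeff (map_poly of_int P :: 'a::{comm_ring_1,ring_char_0} poly) = of_int (lead_coeff P)"
  by (simp add: degree_map_poly_of_int coeff_map_poly)

text \<open>Pseudo-division by a monic polynomial is genuine division over the integers:
  \<open>Q = P * S + T\<close>. If \<open>R\<close> differed from the image of \<open>S\<close>,
  their difference times \<open>P\<close> would be the image of a nonzero \<open>T\<close> of degree
  at least that of \<open>P\<close>. This is what makes the cyclotomic polynomials integral.\<close>

lemma quotient_by_monic_int_poly:
  fixes R :: "'a::{idom,ring_char_0} poly"
  assumes monic: "lead_coeff P = 1"
    and PR: "map_poly of_int P * R = map_poly of_int Q"
  shows "\<exists>S. R = map_poly of_int S"
proof -
  obtain S T where ST: "pseudo_divmod Q P = (S, T)" by fastforce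
  have P0: "P \<noteq> 0" using monic by auto
  have Q: "Q = P * S + T" using pseudo_divmod(1)[OF P0 ST] monic by simp
  have T: "T = 0 \<or> degree T < degree P" using pseudo_divmod(2)[OF P0 ST] .
  have eq: "map_poly of_int P * (R - map_poly of_int S) = map_poly of_int T"
    using PR by (simp add: Q map_poly_of_int_mult map_poly_of_int_add algebra_simps)
  have "R - map_poly of_int S = 0"
  proof (rule ccontr)
    assume nz: "R - map_poly of_int S \<noteq> 0"
    have Pnz: "(map_poly of_int P :: 'a poly) \<noteq> 0"
      using P0 map_poly_of_int_eq_iff[of P 0, where 'a='a] by simp
    have "T \<noteq> 0" using eq nz Pnz by auto
    moreover have "degree T = degree P + degree (R - map_poly of_int S)"
      using arg_cong[OF eq, of degree] nz Pnz
      by (simp add: degree_mult_eq degree_map_poly_of_int)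
    ultimately show False using T by simp
  qed
  then show ?thesis by auto
qed

section \<open>Complex roots of unity and the factorisation of \<open>X^n - 1\<close>\<close>

lemma finite_primitive_roots_of_unity:
  "n > 0 \<Longrightarrow> finite (primitive_roots_of_unity n)"
  by (rule finite_subset[OF _ finite_roots_unity[of n]]) (auto simp: primitive_roots_of_unity_def)

text \<open>Each root is primitive for its own multiplicative order, the least positive
  \<open>d\<close> with \<open>z ^ d = 1\<close>. Reducing \<open>n\<close> modulo \<open>d\<close>
  and using minimality shows that \<open>d\<close> divides \<open>n\<close>.\<close>

lemma roots_of_unity_partition:
  assumes "n > 0"
  shows "{z::complex. z ^ n = 1} = (\<Union>d\<in>{d. d dvd n}. primitive_roots_of_unity d)"
proof (intro equalityI subsetI)
  fix z :: complex assume "z \<in> {z. z ^ n = 1}"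
  then have z: "z ^ n = 1" by simp
  define d where "d = (LEAST d. d > 0 \<and> z ^ d = 1)"
  have d: "d > 0 \<and> z ^ d = 1" unfolding d_def by (rule LeastI[of _ n]) (use z assms in auto)
  have least: "z ^ m \<noteq> 1" if "0 < m" "m < d" for m
    using not_less_Least[of m "\<lambda>d. d > 0 \<and> z ^ d = 1"] that unfolding d_def by auto
  have "z ^ n = (z ^ d) ^ (n div d) * z ^ (n mod d)"
    by (simp flip: power_mult power_add)
  then have "z ^ (n mod d) = 1" using z d by simp
  then have "n mod d = 0" using least[of "n mod d"] d by force
  then show "z \<in> (\<Union>d\<in>{d. d dvd n}. primitive_roots_of_unity d)"
    using d least by (auto simp: primitive_roots_of_unity_def)
next
  fix z assume "z \<in> (\<Union>d\<in>{d. d dvd n}. primitive_roots_of_unity d)"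
  then obtain d where "d dvd n" "z ^ d = 1" by (auto simp: primitive_roots_of_unity_def)
  then show "z \<in> {z. z ^ n = 1}" by (auto simp: power_mult elim!: dvdE)
qed

lemma primitive_roots_of_unity_disjoint:
  assumes "0 < c" "0 < d" "c \<noteq> d"
  shows "primitive_roots_of_unity c \<inter> primitive_roots_of_unity d = {}"
  using assms unfolding primitive_roots_of_unity_def
  by (auto simp: neq_iff)

text \<open>Both sides are monic of degree \<open>n\<close> and vanish at the same \<open>n\<close>
  points, which determines a polynomial of that degree.\<close>

lemma monom_minus_1_eq_prod_roots:
  assumes "n > 0"
  shows "(monom 1 n - 1 :: complex poly) = (\<Prod>z\<in>{z. z ^ n = 1}. [:-z, 1:])"
proof (rule poly_eqI_degree_lead_coeff[where n = n and A = "{z. z ^ n = 1}"])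
  have card: "card {z::complex. z ^ n = 1} = n" using card_roots_unity_eq assms .
  have deg: "degree (\<Prod>z\<in>{z::complex. z ^ n = 1}. [:-z, 1:]) = n"
    by (subst degree_prod_eq_sum_degree) (auto simp: card)
  have "lead_coeff (\<Prod>z\<in>{z::complex. z ^ n = 1}. [:-z, 1:]) = 1"
    by (simp add: lead_coeff_prod)
  with deg show "coeff (monom 1 n - 1) n = coeff (\<Prod>z\<in>{z::complex. z ^ n = 1}. [:-z, 1:]) n"
    using assms by (simp add: coeff_1)
  show "degree (\<Prod>z\<in>{z::complex. z ^ n = 1}. [:-z, 1:]) \<le> n" using deg by simp
  show "n \<le> card {z::complex. z ^ n = 1}" using card by simp
  show "degree (monom 1 n - 1 :: complex poly) \<le> n"
    by (intro degree_diff_le) (auto simp: degree_monom_le)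
  fix z :: complex assume z: "z \<in> {z. z ^ n = 1}"
  have "poly (\<Prod>z\<in>{z. z ^ n = 1}. [:-z, 1:]) z = 0"
    using z assms finite_roots_unity[of n, where 'a=complex]
    by (simp add: poly_prod)
  then show "poly (monom 1 n - 1) z = poly (\<Prod>z\<in>{z. z ^ n = 1}. [:-z, 1:]) z"
    using z by (simp add: poly_monom)
qed

lemma monom_minus_1_eq_prod_primitive_roots:
  assumes "n > 0"
  shows "(monom 1 n - 1 :: complex poly)
       = (\<Prod>d\<in>{d. d dvd n}. \<Prod>z\<in>primitive_roots_of_unity d. [:-z, 1:])"
  unfolding monom_minus_1_eq_prod_roots[OF assms] roots_of_unity_partition[OF assms]
proof (rule prod.UNION_disjoint)
  show "finite {d. d dvd n}" using assms by simp
  show "\<forall>d\<in>{d. d dvd n}. finite (primitive_roots_of_unity d)"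
    using assms by (auto intro!: finite_primitive_roots_of_unity dvd_pos_nat[OF assms])
  show "\<forall>c\<in>{d. d dvd n}. \<forall>d\<in>{d. d dvd n}. c \<noteq> d \<longrightarrow>
      primitive_roots_of_unity c \<inter> primitive_roots_of_unity d = {}"
    using assms primitive_roots_of_unity_disjoint by (metis dvd_pos_nat mem_Collect_eq)
qed

section \<open>Integral cyclotomic polynomials: existence, product formula, degree\<close>

lemma divisors_eq_insert:
  "n > 0 \<Longrightarrow> {d::nat. d dvd n} = insert n {d. d dvd n \<and> d < n}"
  by (auto dest: dvd_imp_le)

text \<open>By strong induction the factors of \<open>X^n - 1\<close> for the proper divisors of
  \<open>n\<close> have a monic integral product. The factor for \<open>n\<close> itself is the
  quotient of \<open>X^n - 1\<close> by that product, hence integral too.\<close>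

lemma ex_cyclotomic_int:
  "n > 0 \<Longrightarrow> \<exists>P. map_poly of_int P = (\<Prod>z\<in>primitive_roots_of_unity n. [:- z, 1:])"
proof (induction n rule: less_induct)
  case (less n)
  have "\<forall>d\<in>{d. d dvd n \<and> d < n}.
      \<exists>P. map_poly of_int P = (\<Prod>z\<in>primitive_roots_of_unity d. [:- z, 1:])"
    using less by (auto intro: dvd_pos_nat[OF \<open>n > 0\<close>])
  then obtain P where P: "\<forall>d\<in>{d. d dvd n \<and> d < n}.
      map_poly of_int (P d) = (\<Prod>z\<in>primitive_roots_of_unity d. [:- z, 1:])"
    by metis
  define Q where "Q = (\<Prod>d\<in>{d. d dvd n \<and> d < n}. P d)"
  have Q: "map_poly of_int Q
      = (\<Prod>d\<in>{d. d dvd n \<and> d < n}. \<Prod>z\<in>primitive_roots_of_unity d. [:- z, 1:])"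
    unfolding Q_def map_poly_of_int_prod using P by (intro prod.cong) auto
  have "of_int (lead_coeff Q) = (1::complex)"
    unfolding lead_coeff_map_poly_of_int[symmetric] Q by (simp add: lead_coeff_prod)
  then have "lead_coeff Q = 1" by simp
  moreover have "map_poly of_int Q * (\<Prod>z\<in>primitive_roots_of_unity n. [:- z, 1:])
      = map_poly of_int (monom 1 n - 1)"
    unfolding map_poly_of_int_monom_minus_1 monom_minus_1_eq_prod_primitive_roots[OF \<open>n > 0\<close>]
      divisors_eq_insert[OF \<open>n > 0\<close>] Q
    by (simp add: mult.commute)
  ultimately show ?case using quotient_by_monic_int_poly by metis
qed

text \<open>The description in \<open>cyclotomic_int\<close> is well defined because integer
  polynomials embed injectively into the complex ones.\<close>

lemma map_poly_cyclotomic_int: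
  assumes "n > 0"
  shows "map_poly of_int (cyclotomic_int n) = (\<Prod>z\<in>primitive_roots_of_unity n. [:- z, 1:])"
  unfolding cyclotomic_int_def
  using ex_cyclotomic_int[OF assms]
  by (rule theI'[OF ex_ex1I]) (metis map_poly_of_int_eq_iff)

lemma lead_coeff_cyclotomic_int:
  assumes "n > 0"
  shows "lead_coeff (cyclotomic_int n) = 1"
proof -
  have "of_int (lead_coeff (cyclotomic_int n)) = (1::complex)"
    unfolding lead_coeff_map_poly_of_int[symmetric] map_poly_cyclotomic_int[OF assms]
    by (simp add: lead_coeff_prod)
  then show ?thesis by simp
qed

lemma cyclotomic_int_nonzero: "n > 0 \<Longrightarrow> cyclotomic_int n \<noteq> 0"
  using lead_coeff_cyclotomic_int[of n] by auto

lemma monom_minus_1_eq_prod_cyclotomic_int: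
  assumes "n > 0"
  shows "monom 1 n - 1 = (\<Prod>d\<in>{d. d dvd n}. cyclotomic_int d)"
proof -
  have "map_poly of_int (monom 1 n - 1)
      = (map_poly of_int (\<Prod>d\<in>{d. d dvd n}. cyclotomic_int d) :: complex poly)"
    unfolding map_poly_of_int_monom_minus_1 map_poly_of_int_prod
      monom_minus_1_eq_prod_primitive_roots[OF assms]
    using assms by (intro prod.cong refl) (auto simp: map_poly_cyclotomic_int intro: dvd_pos_nat[OF assms])
  then show ?thesis by (simp only: map_poly_of_int_eq_iff)
qed

lemma degree_monom_minus_1:
  "n > 0 \<Longrightarrow> degree (monom 1 n - 1 :: int poly) = n"
  using degree_add_eq_left[of "-1" "monom 1 n :: int poly"] by (simp add: degree_monom_eq)

text \<open>Comparing degrees in the product formula, the degrees sum to \<open>n\<close> over the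
  divisors of \<open>n\<close>, just as the totients do. Strong induction cancels the proper
  divisors.\<close>

lemma degree_cyclotomic_int: "n > 0 \<Longrightarrow> degree (cyclotomic_int n) = totient n"
proof (induction n rule: less_induct)
  case (less n)
  have "(\<Sum>d\<in>{d. d dvd n}. degree (cyclotomic_int d)) = n"
    using degree_monom_minus_1[OF \<open>n > 0\<close>] less.prems
    unfolding monom_minus_1_eq_prod_cyclotomic_int[OF \<open>n > 0\<close>]
    by (subst (asm) degree_prod_eq_sum_degree) (auto simp: cyclotomic_int_nonzero dvd_pos_nat[OF \<open>n > 0\<close>])
  then have "degree (cyclotomic_int n) + (\<Sum>d\<in>{d. d dvd n \<and> d < n}. degree (cyclotomic_int d))
      = totient n + (\<Sum>d\<in>{d. d dvd n \<and> d < n}. totient d)"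
    using totient_divisor_sum[of n] less.prems by (simp add: divisors_eq_insert)
  moreover have "(\<Sum>d\<in>{d. d dvd n \<and> d < n}. degree (cyclotomic_int d))
      = (\<Sum>d\<in>{d. d dvd n \<and> d < n}. totient d)"
    using less by (intro sum.cong refl) (auto intro: dvd_pos_nat[OF \<open>n > 0\<close>])
  ultimately show ?case by simp
qed

lemma cyclotomic_int_1: "cyclotomic_int (Suc 0) = [:-1, 1:]"
  using monom_minus_1_eq_prod_cyclotomic_int[of 1] by (simp add: monom_altdef one_pCons)

section \<open>Palindromicity of the cyclotomic polynomials\<close>

lemma reflect_poly_monom_minus_1:
  assumes "n > 0"
  shows "reflect_poly (monom 1 n - 1 :: int poly) = - (monom 1 n - 1)"
  using assms
  by (auto simp: poly_eq_iff coeff_reflect_poly degree_monom_minus_1 coeff_1)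

text \<open>Reflection is multiplicative and negates both \<open>X^n - 1\<close> and its factor
  \<open>X - 1\<close>. The signs cancel, the other proper factors are fixed by induction, and so
  the remaining factor is fixed as well.\<close>

lemma reflect_poly_cyclotomic_int:
  "n > 1 \<Longrightarrow> reflect_poly (cyclotomic_int n) = cyclotomic_int n"
proof (induction n rule: less_induct)
  case (less n)
  have n0: "n > 0" using less.prems by simp
  \<comment> \<open>The divisor 1 is kept apart, since its factor \<open>X - 1\<close> is
    antipalindromic and carries the sign.\<close>
  define Q where "Q = (\<Prod>d\<in>{d. d dvd n \<and> d < n \<and> d \<noteq> 1}. cyclotomic_int d)"
  have "{d. d dvd n} = insert n (insert 1 {d. d dvd n \<and> d < n \<and> d \<noteq> 1})"
    using less.prems by (auto dest: dvd_imp_le)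
  then have eq: "monom 1 n - 1 = cyclotomic_int n * (cyclotomic_int 1 * Q)"
    using less.prems by (simp add: monom_minus_1_eq_prod_cyclotomic_int Q_def)
  have "reflect_poly (cyclotomic_int d) = cyclotomic_int d"
    if "d dvd n" "d < n" "d \<noteq> 1" for d
  proof -
    have "d > 0" using that less.prems by (auto intro: dvd_pos_nat[OF n0])
    then show ?thesis using less.IH[of d] that by simp
  qed
  then have Q: "reflect_poly Q = Q"
    unfolding Q_def reflect_poly_prod by (intro prod.cong refl) auto
  have 1: "reflect_poly (cyclotomic_int (Suc 0)) = - cyclotomic_int (Suc 0)"
    by (simp add: cyclotomic_int_1 reflect_poly_pCons)
  have "Q \<noteq> 0"
    using less.prems by (auto simp: Q_def cyclotomic_int_nonzero dvd_pos_nat[OF n0])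
  have "- (cyclotomic_int n * (cyclotomic_int 1 * Q))
      = reflect_poly (cyclotomic_int n * (cyclotomic_int 1 * Q))"
    using reflect_poly_monom_minus_1[of n] less.prems by (simp add: eq)
  also have "\<dots> = - (reflect_poly (cyclotomic_int n) * (cyclotomic_int 1 * Q))"
    by (simp add: reflect_poly_mult Q 1)
  finally show ?case
    using \<open>Q \<noteq> 0\<close> cyclotomic_int_nonzero[of 1] by simp
qed

lemma cyclotomic_int_coeff_symmetric:
  assumes "n > 1" "i \<le> totient n"
  shows "coeff (cyclotomic_int n) i = coeff (cyclotomic_int n) (totient n - i)"
  using arg_cong[OF reflect_poly_cyclotomic_int[OF assms(1)], of "\<lambda>p. coeff p i"] assms
  by (simp add: coeff_reflect_poly degree_cyclotomic_int)

section \<open>The embedding into the algebraic closure, the two roots, and Binet's formulas\<close>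

lemma emb_0 [simp]: "emb 0 = 0"
  and emb_1 [simp]: "emb 1 = 1"
  and emb_add [simp]: "emb (P + Q) = emb P + emb Q"
  and emb_diff [simp]: "emb (P - Q) = emb P - emb Q"
  and emb_uminus [simp]: "emb (- P) = - emb P"
  and emb_mult [simp]: "emb (P * Q) = emb P * emb Q"
  and emb_eq_iff [simp]: "emb P = emb Q \<longleftrightarrow> P = Q"
  by (simp_all add: emb_def)

lemma emb_of_nat [simp]: "emb (of_nat k) = of_nat k"
  by (induction k) simp_all

lemma emb_of_int [simp]: "emb (of_int k) = of_int k"
  by (cases k rule: int_cases2) simp_all

lemma emb_prod: "emb (prod f A) = (\<Prod>x\<in>A. emb (f x))"
  by (induction A rule: infinite_finite_induct) simp_all

text \<open>Integers have the same image in the closure whether or not they pass through the base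
  field. All later work can therefore use the integral coefficients, in any characteristic.\<close>

lemma map_poly_emb_const_cyclotomic:
  "map_poly emb_const (cyclotomic n) = map_poly of_int (cyclotomic_int n)"
proof -
  have "emb_const (of_int k :: 'a) = of_int k" for k
    by (simp add: emb_const_def flip: of_int_poly)
  then show ?thesis
    by (simp add: cyclotomic_def poly_eq_iff coeff_map_poly emb_const_def)
qed

lemma lucas_roots_sum_prod:
  assumes "lucas_roots \<alpha> \<beta>"
  shows "\<alpha> + \<beta> = - emb indet_B" "\<alpha> * \<beta> = emb indet_C"
proof -
  have "\<alpha> * \<beta> = emb indet_C" "emb indet_B = - \<alpha> - \<beta>"
    using assms by (auto simp: lucas_roots_def)
  then show "\<alpha> + \<beta> = - emb indet_B" "\<alpha> * \<beta> = emb indet_C" by simp_all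
qed

lemma ex_lucas_roots: "\<exists>\<alpha> \<beta> :: 'a::field lucas_closure. lucas_roots \<alpha> \<beta>"
proof -
  obtain \<alpha> :: "'a lucas_closure" where "poly [:emb indet_C, emb indet_B, 1:] \<alpha> = 0"
    using alg_closed_imp_poly_has_root[of "[:emb indet_C, emb indet_B, 1:]"] by auto
  then have "emb indet_C = - (\<alpha> * (emb indet_B + \<alpha>))"
    by (simp add: add_eq_0_iff2)
  \<comment> \<open>The second root is forced by the sum of the roots being
    \<open>-B\<close>.\<close>
  then have "lucas_roots \<alpha> (- emb indet_B - \<alpha>)"
    by (simp add: lucas_roots_def algebra_simps)
  then show ?thesis by blast
qed

text \<open>Binet's formula with the denominator cleared. Both sides obey the recurrence with
  coefficients \<alpha> + \<beta> and -\<alpha>\<beta>.\<close>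

lemma lucas_U_roots:
  assumes "lucas_roots \<alpha> \<beta>"
  shows "(\<alpha> - \<beta>) * emb (lucas_U n) = \<alpha> ^ n - \<beta> ^ n"
proof (induction n rule: lucas_U.induct)
  case (3 n)
  have "(\<alpha> - \<beta>) * emb (lucas_U (Suc (Suc n)))
      = (\<alpha> + \<beta>) * ((\<alpha> - \<beta>) * emb (lucas_U (Suc n))) - \<alpha> * \<beta> * ((\<alpha> - \<beta>) * emb (lucas_U n))"
    by (simp add: lucas_roots_sum_prod[OF assms] algebra_simps)
  also have "\<dots> = \<alpha> ^ Suc (Suc n) - \<beta> ^ Suc (Suc n)"
    unfolding 3 by (simp add: algebra_simps)
  finally show ?case .
qed simp_all

lemma lucas_V_roots:
  assumes "lucas_roots \<alpha> \<beta>"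
  shows "emb (lucas_V n) = \<alpha> ^ n + \<beta> ^ n"
proof (induction n rule: lucas_V.induct)
  case 1
  then show ?case using emb_of_nat[of 2, where 'a='a] by simp
next
  case 2
  then show ?case by (simp add: lucas_roots_sum_prod[OF assms])
next
  case (3 n)
  have "emb (lucas_V (Suc (Suc n)))
      = (\<alpha> + \<beta>) * emb (lucas_V (Suc n)) - \<alpha> * \<beta> * emb (lucas_V n)"
    by (simp add: lucas_roots_sum_prod[OF assms])
  also have "\<dots> = \<alpha> ^ Suc (Suc n) + \<beta> ^ Suc (Suc n)"
    unfolding 3 by (simp add: algebra_simps)
  finally show ?case .
qed

lemma lucas_U_nonzero:
  assumes "n > 0"
  shows "(lucas_U n :: 'a::comm_ring_1 poly poly) \<noteq> 0"
proof -
  \<comment> \<open>Under the specialisation \<open>B = -1\<close>, \<open>C = 0\<close> the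
    recurrence reads \<open>U (n + 2) = U (n + 1)\<close>.\<close>
  have "poly (poly (lucas_U n :: 'a poly poly) (-1)) 0 = (if n = 0 then 0 else 1)"
    by (induction n rule: lucas_U.induct) (simp_all add: indet_B_def indet_C_def)
  then show ?thesis using assms by auto
qed

text \<open>A double root would give \<open>B^2 = 4 C\<close>, which the specialisation
  \<open>B = 1\<close>, \<open>C = 0\<close> turns into \<open>1 = 0\<close>. This argument also
  covers characteristic 2.\<close>

lemma lucas_roots_distinct:
  assumes "lucas_roots \<alpha> \<beta>"
  shows "\<alpha> \<noteq> \<beta>"
proof
  assume "\<alpha> = \<beta>"
  then have B: "emb indet_B = - (2 * \<beta>)" and C: "emb indet_C = \<beta> * \<beta>"
    using lucas_roots_sum_prod[OF assms] by simp_all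
  have "emb (indet_B * indet_B) = emb (of_nat 4 * indet_C :: 'a poly poly)"
    unfolding emb_mult emb_of_nat B C by simp
  then have "(indet_B * indet_B :: 'a poly poly) = of_nat 4 * indet_C"
    by (simp only: emb_eq_iff)
  then have "poly (poly (indet_B * indet_B) 1) 0 = poly (poly (of_nat 4 * indet_C :: 'a poly poly) 1) 0"
    by simp
  then show False by (simp add: indet_B_def indet_C_def)
qed

lemma lucas_roots_nonzero:
  assumes "lucas_roots \<alpha> \<beta>"
  shows "\<beta> \<noteq> 0"
proof
  assume "\<beta> = 0"
  then have "emb indet_C = (emb 0 :: 'a lucas_closure)"
    using lucas_roots_sum_prod(2)[OF assms] by simp
  then show False by (simp only: emb_eq_iff) (simp add: indet_C_def)
qed

section \<open>Existence and uniqueness of the Lucas atoms\<close>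

text \<open>Induction in steps of two: the two end terms combine to \<open>c 0\<close> times
  \<open>V m\<close>, and the inner terms are \<alpha>\<beta> = \<open>C\<close> times a palindromic
  form of degree \<open>m - 2\<close>. The polynomial so built serves every ordering of the
  roots.\<close>

lemma palindromic_form_in_range_emb:
  fixes c :: "nat \<Rightarrow> int"
  assumes "\<And>i. i \<le> m \<Longrightarrow> c i = c (m - i)"
  shows "\<exists>L :: 'a::field poly poly. \<forall>\<alpha> \<beta>. lucas_roots \<alpha> \<beta> \<longrightarrow>
    emb L = (\<Sum>i\<le>m. of_int (c i) * \<alpha> ^ i * \<beta> ^ (m - i))"
  using assms
proof (induction m arbitrary: c rule: induct_nat_012)
  case 0
  \<comment> \<open>For \<open>m = 0\<close> the two end terms coincide, so \<open>V 0 = 2\<close>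
    must not appear.\<close>
  show ?case by (rule exI[of _ "of_int (c 0)"]) simp
next
  case 1
  have "c 1 = c 0" using 1[of 1] by simp
  then show ?case
    by (intro exI[of _ "of_int (c 0) * lucas_V 1"])
      (auto simp: lucas_V_roots algebra_simps simp del: lucas_V.simps)
next
  case (ge2 m)
  have "\<exists>L :: 'a poly poly. \<forall>\<alpha> \<beta>. lucas_roots \<alpha> \<beta> \<longrightarrow>
      emb L = (\<Sum>i\<le>m. of_int (c (Suc i)) * \<alpha> ^ i * \<beta> ^ (m - i))"
  proof (rule ge2.IH(1))
    fix i assume "i \<le> m"
    then show "c (Suc i) = c (Suc (m - i))"
      using ge2.prems[of "Suc i"] by (simp add: Suc_diff_le)
  qed
  then obtain L :: "'a poly poly" where L: "\<And>\<alpha> \<beta>. lucas_roots \<alpha> \<beta> \<Longrightarrow>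
      emb L = (\<Sum>i\<le>m. of_int (c (Suc i)) * \<alpha> ^ i * \<beta> ^ (m - i))" by blast
  have c: "c (Suc (Suc m)) = c 0" using ge2.prems[of 0] by simp
  show ?case
  proof (intro exI allI impI)
    fix \<alpha> \<beta> :: "'a lucas_closure" assume r: "lucas_roots \<alpha> \<beta>"
    have "(\<Sum>i\<le>m. of_int (c (Suc i)) * \<alpha> ^ Suc i * \<beta> ^ (Suc m - i)) = \<alpha> * \<beta> * emb L"
      unfolding L[OF r] sum_distrib_left
      by (intro sum.cong refl) (simp add: Suc_diff_le mult_ac)
    then show "emb (of_int (c 0) * lucas_V (Suc (Suc m)) + indet_C * L)
        = (\<Sum>i\<le>Suc (Suc m). of_int (c i) * \<alpha> ^ i * \<beta> ^ (Suc (Suc m) - i))"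
      by (subst sum.atMost_Suc, subst sum.atMost_Suc_shift)
        (simp add: c lucas_V_roots[OF r] lucas_roots_sum_prod[OF r] algebra_simps
          del: lucas_V.simps sum.atMost_Suc)
  qed
qed

lemma cyclotomic_hom_eq_sum:
  assumes "n > 0" "\<beta> \<noteq> 0"
  shows "cyclotomic_hom n \<alpha> \<beta>
    = (\<Sum>i\<le>totient n. of_int (coeff (cyclotomic_int n) i) * \<alpha> ^ i * \<beta> ^ (totient n - i))"
proof -
  let ?P = "map_poly of_int (cyclotomic_int n) :: 'a lucas_closure poly"
  have "degree ?P \<le> totient n"
    using map_poly_degree_leq degree_cyclotomic_int[OF assms(1)] by metis
  then have "poly ?P (\<alpha> / \<beta>) = (\<Sum>i\<le>totient n. coeff ?P i * (\<alpha> / \<beta>) ^ i)"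
    \<comment> \<open>A bound on the degree is enough: the sum is padded with zero coefficients up
      to \<open>totient n\<close>.\<close>
    unfolding poly_altdef by (intro sum.mono_neutral_left) (auto simp: coeff_eq_0)
  then show ?thesis
    using assms unfolding cyclotomic_hom_def map_poly_emb_const_cyclotomic
    by (auto simp: sum_distrib_left coeff_map_poly power_diff power_divide intro!: sum.cong)
qed

lemma emb_lucas_atom:
  assumes "n > 1" "lucas_roots \<alpha> \<beta>"
  shows "emb (lucas_atom n) = cyclotomic_hom n \<alpha> \<beta>"
proof -
  have "\<exists>L :: 'a poly poly. \<forall>\<alpha> \<beta>. lucas_roots \<alpha> \<beta> \<longrightarrow>
      emb L = (\<Sum>i\<le>totient n. of_int (coeff (cyclotomic_int n) i) * \<alpha> ^ i * \<beta> ^ (totient n - i))"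
    using assms(1) by (intro palindromic_form_in_range_emb cyclotomic_int_coeff_symmetric)
  then have "\<exists>L :: 'a poly poly. \<forall>\<alpha> \<beta>. lucas_roots \<alpha> \<beta> \<longrightarrow> emb L = cyclotomic_hom n \<alpha> \<beta>"
    using assms(1) by (simp add: cyclotomic_hom_eq_sum lucas_roots_nonzero cong: imp_cong)
  \<comment> \<open>Uniqueness rests on the injectivity of \<open>emb\<close> and on the given pair
    of roots, without which the condition would be vacuous.\<close>
  then have "\<exists>!L :: 'a poly poly. \<forall>\<alpha> \<beta>. lucas_roots \<alpha> \<beta> \<longrightarrow> emb L = cyclotomic_hom n \<alpha> \<beta>"
    using assms(2) by (metis emb_eq_iff)
  from theI'[OF this] show ?thesis
    using assms by (simp add: lucas_atom_def)
qed

section \<open>The product formulas for the two Lucas sequences\<close>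

text \<open>This is the homogenised factorisation of \<open>X^n - 1\<close>: the powers of \<beta>
  collect to \<beta>\<open>^n\<close> because the totients of the divisors sum to
  \<open>n\<close>.\<close>

lemma prod_cyclotomic_hom:
  assumes "n > 0" "\<beta> \<noteq> 0"
  shows "(\<Prod>d\<in>{d. d dvd n}. cyclotomic_hom d \<alpha> \<beta>) = \<alpha> ^ n - \<beta> ^ n"
proof -
  have "(\<Prod>d\<in>{d. d dvd n}. cyclotomic_hom d \<alpha> \<beta>)
      = \<beta> ^ n * poly (map_poly of_int (\<Prod>d\<in>{d. d dvd n}. cyclotomic_int d)) (\<alpha> / \<beta>)"
    unfolding cyclotomic_hom_def map_poly_emb_const_cyclotomic
    by (simp add: prod.distrib map_poly_of_int_prod poly_prod totient_divisor_sum flip: power_sum)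
  also have "\<dots> = \<beta> ^ n * ((\<alpha> / \<beta>) ^ n - 1)"
    unfolding monom_minus_1_eq_prod_cyclotomic_int[OF assms(1), symmetric]
      map_poly_of_int_monom_minus_1
    by (simp add: poly_monom)
  also have "\<dots> = \<alpha> ^ n - \<beta> ^ n"
    using assms by (simp add: field_simps)
  finally show ?thesis .
qed

lemma cyclotomic_hom_1:
  assumes "\<beta> \<noteq> 0"
  shows "cyclotomic_hom (Suc 0) \<alpha> \<beta> = \<alpha> - \<beta>"
  using prod_cyclotomic_hom[of 1 \<beta> \<alpha>] assms by simp

lemma lucas_U_eq_prod_lucas_atom:
  assumes "n > 0"
  shows "lucas_U n = (\<Prod>d\<in>{d. d dvd n \<and> d > 1}. lucas_atom d :: 'a::field poly poly)"
proof -
  obtain \<alpha> \<beta> :: "'a lucas_closure" where r: "lucas_roots \<alpha> \<beta>"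
    using ex_lucas_roots by blast
  have div: "{d. d dvd n} = insert 1 {d. d dvd n \<and> d > 1}"
    using assms by (auto intro: Suc_lessI dvd_pos_nat[OF assms])
  \<comment> \<open>The factor \<alpha> - \<beta> from Binet's formula plays the part of the missing
    divisor 1, where the homogenised cyclotomic value differs from
    \<open>lucas_atom 1 = 1\<close>.\<close>
  have "(\<alpha> - \<beta>) * emb (\<Prod>d\<in>{d. d dvd n \<and> d > 1}. lucas_atom d)
      = cyclotomic_hom 1 \<alpha> \<beta> * (\<Prod>d\<in>{d. d dvd n \<and> d > 1}. cyclotomic_hom d \<alpha> \<beta>)"
    using r by (simp add: emb_prod emb_lucas_atom cyclotomic_hom_1
        lucas_roots_nonzero)
  also have "\<dots> = (\<Prod>d\<in>{d. d dvd n}. cyclotomic_hom d \<alpha> \<beta>)"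
    unfolding div using assms by (subst prod.insert) auto
  also have "\<dots> = (\<alpha> - \<beta>) * emb (lucas_U n)"
    using assms r by (simp add: prod_cyclotomic_hom lucas_U_roots lucas_roots_nonzero)
  finally show ?thesis using lucas_roots_distinct[OF r] by simp
qed

text \<open>After multiplication by \<alpha> - \<beta> this is the difference of the squares of
  \<alpha>\<open>^n\<close> and \<beta>\<open>^n\<close>.\<close>

lemma lucas_U_double: "lucas_U (2 * n) = lucas_U n * (lucas_V n :: 'a::field poly poly)"
proof -
  obtain \<alpha> \<beta> :: "'a lucas_closure" where r: "lucas_roots \<alpha> \<beta>"
    using ex_lucas_roots by blast
  have "(\<alpha> - \<beta>) * emb (lucas_U (2 * n)) = ((\<alpha> - \<beta>) * emb (lucas_U n)) * emb (lucas_V n)"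
    unfolding lucas_U_roots[OF r] lucas_V_roots[OF r]
    by (simp add: algebra_simps mult_2_right power_add)
  then have "emb (lucas_U (2 * n)) = emb (lucas_U n * lucas_V n :: 'a poly poly)"
    using lucas_roots_distinct[OF r] by simp
  then show ?thesis by (simp only: emb_eq_iff)
qed

text \<open>In the product for \<open>U (2 * n) = U n * V n\<close>, the divisors of
  \<open>n\<close> account for \<open>U n\<close>. Cancelling this nonzero factor leaves the
  divisors of \<open>2 * n\<close> that do not divide \<open>n\<close>.\<close>

lemma lucas_V_eq_prod_lucas_atom:
  assumes "n > 0"
  shows "lucas_V n = (\<Prod>d\<in>{d. d dvd 2 * n \<and> \<not> d dvd n}. lucas_atom d :: 'a::field poly poly)"
proof -
  have "2 * n > 0" using assms by simp
  then have split: "{d. d dvd 2 * n \<and> d > 1} = {d. d dvd n \<and> d > 1} \<union> {d. d dvd 2 * n \<and> \<not> d dvd n}"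
    by (auto intro!: Suc_lessI dvd_pos_nat[OF \<open>2 * n > 0\<close>])
  have "lucas_U n * lucas_V n = (\<Prod>d\<in>{d. d dvd 2 * n \<and> d > 1}. lucas_atom d :: 'a poly poly)"
    using lucas_U_eq_prod_lucas_atom[of "2 * n"] assms by (simp add: lucas_U_double)
  also have "\<dots> = lucas_U n * (\<Prod>d\<in>{d. d dvd 2 * n \<and> \<not> d dvd n}. lucas_atom d)"
    unfolding split lucas_U_eq_prod_lucas_atom[OF assms]
    using assms by (intro prod.union_disjoint) auto
  finally show ?thesis using lucas_U_nonzero[OF assms, where 'a='a] by simp
qed

theorem theorem3p7:
  fixes p k q n :: nat
  assumes "prime p" and "k \<ge> 1" and "q = p ^ k"
    and "card (UNIV :: 'a::{field,finite} set) = q"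
    and "n \<ge> 1"
  shows "(lucas_U n :: 'a poly poly) = (\<Prod>d\<in>{d. d dvd n \<and> d > 1}. lucas_atom d)
       \<and> (lucas_V n :: 'a poly poly) = (\<Prod>d\<in>{d. d dvd 2 * n \<and> \<not> d dvd n}. lucas_atom d)"
  using lucas_U_eq_prod_lucas_atom[of n] lucas_V_eq_prod_lucas_atom[of n] assms(5) by simp

end
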